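(* Let $D\subset\mathbb{C}$ be an open simply connected domain, $N\ge 1$, and let $A$ be an $(N\times N)$-matrix function on $D$. Consider the system $$\partial_{\bar z}\Psi + A\Psi = 0 \qquad (\mathrm{I}_A)$$ for $(N\times N)$-matrix functions $\Psi$ on $D$. Let $F$ be an arbitrary fixed solution of $(\mathrm{I}_A)$ and let $F^+$ be an arbitrary fixed $(N\times N)$-matrix function on $D$. For a matrix function $\Phi$ on $D$, let $\hat\omega_{\Phi,F^+}$ denote an $(N\times N)$-matrix function on $D$ satisfying $$\partial_{\bar z}\,\hat\omega_{\Phi,F^+} = F^+\Phi .$$ Suppose that $\det\hat\omega_{F,F^+}\neq 0$ everywhere on $D$, and put $$\tilde A = A + F\,\hat\omega_{F,F^+}^{-1}\,F^+ .$$ Then system $(\mathrm{I}_A)$ is mapped to a system of the same type with $A$ replaced by $\tilde A$, in the following sense: for every solution $\Psi$ of $(\mathrm{I}_A)$, the function $$\tilde\Psi = \Psi - F\,\hat\omega_{F,F^+}^{-1}\,\hat\omega_{\Psi,F^+}$$ satisfies $$\partial_{\bar z}\tilde\Psi + \tilde A\,\tilde\Psi = 0 .$$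
   Context: All matrix functions take values in complex $(N\times N)$-matrices; $z=x+iy$ is the coordinate on $D$ and $\partial_{\bar z}=\frac12(\partial_x+i\partial_y)$ acts entrywise. Functions that are differentiated are assumed to be differentiable (in the real sense) and the equations hold pointwise on $D$. $\hat\omega_{F,F^+}$ and $\hat\omega_{\Psi,F^+}$ denote any fixed choices of functions satisfying the stated equation (with $\Phi=F$ and $\Phi=\Psi$, respectively); they are not required to be purely imaginary. *)

theory Defs
  imports "HOL-Analysis.Analysis"
begin

text \<open>
  \<open>frechet_derivative\<close> is the real-linear derivative, so its values in the directions \<open>1\<close>
  and \<open>\<i>\<close> are the partial derivatives with respect to \<open>x\<close> and \<open>y\<close>, where \<open>z = x + \<i> y\<close>.
  It is meaningful only where the function is differentiable; the predicates below
  therefore require differentiability explicitly.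
\<close>

definition dbar :: "(complex \<Rightarrow> complex) \<Rightarrow> complex \<Rightarrow> complex" where
  "dbar f z = (frechet_derivative f (at z) 1 + \<i> * frechet_derivative f (at z) \<i>) / 2"

definition mat_dbar :: "(complex \<Rightarrow> complex^'n^'n) \<Rightarrow> complex \<Rightarrow> complex^'n^'n" where
  "mat_dbar M z = (\<chi> i j. dbar (\<lambda>w. M w $ i $ j) z)"

definition solves_system ::
  "complex set \<Rightarrow> (complex \<Rightarrow> complex^'n^'n) \<Rightarrow> (complex \<Rightarrow> complex^'n^'n) \<Rightarrow> bool" where
  "solves_system D A \<Psi> \<longleftrightarrow>
     (\<forall>z\<in>D. \<Psi> differentiable (at z) \<and> mat_dbar \<Psi> z + A z ** \<Psi> z = 0)"

text \<open>\<open>is_potential D Fp \<Phi> \<omega>\<close>: \<open>\<omega>\<close> is an admissible choice of the function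
  determined by \<open>\<Phi>\<close> and \<open>Fp\<close> through its \<open>dbar\<close>-derivative; it is not unique.\<close>

definition is_potential ::
  "complex set \<Rightarrow> (complex \<Rightarrow> complex^'n^'n) \<Rightarrow> (complex \<Rightarrow> complex^'n^'n) \<Rightarrow>
     (complex \<Rightarrow> complex^'n^'n) \<Rightarrow> bool" where
  "is_potential D Fp \<Phi> \<omega> \<longleftrightarrow>
     (\<forall>z\<in>D. \<omega> differentiable (at z) \<and> mat_dbar \<omega> z = Fp z ** \<Phi> z)"

end

theory Submission
  imports Defs
begin

text \<open>
  Write \<open>\<partial>\<close> for \<open>mat_dbar\<close>, and put \<open>W = \<omega>F\<^sup>-\<^sup>1 \<omega>\<Psi>\<close>, so that the transformed function is
  \<open>\<Psi>' = \<Psi> - F W\<close>. The operator \<open>\<partial>\<close> is a complex-linear combination of partial derivatives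
  and therefore obeys the product rule (\<open>mat_dbar_mult\<close>). Applied to \<open>\<omega>F W = \<omega>\<Psi>\<close>, it gives
  \<open>Fp F W + \<omega>F \<partial>W = Fp \<Psi>\<close>, that is, \<open>\<partial>W = \<omega>F\<^sup>-\<^sup>1 Fp \<Psi>'\<close> (\<open>mat_dbar_matrix_inv_mult\<close>). Hence
  \<open>\<partial>\<Psi>' = - A \<Psi> + A F W - F \<partial>W = - (A + F \<omega>F\<^sup>-\<^sup>1 Fp) \<Psi>'\<close>.

  This argument presupposes that \<open>W\<close> is differentiable, which follows from Cramer's rule
  (\<open>differentiable_matrix_inv_mult\<close>).
\<close>

section \<open>Differentiability of matrix functions\<close>

text \<open>Differentiability is tested on coordinates, and every basis vector of a product space is
  supported in a single component.\<close>

lemma differentiable_vecI: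
  fixes f :: "'a::real_normed_vector \<Rightarrow> 'b::euclidean_space^'n"
  assumes "\<And>i. (\<lambda>z. f z $ i) differentiable (at z within S)"
  shows "f differentiable (at z within S)"
proof -
  have "(\<lambda>z. f z \<bullet> b) differentiable (at z within S)" if "b \<in> Basis" for b
  proof -
    obtain i u where b: "b = axis i u"
      using \<open>b \<in> Basis\<close> by (auto simp: Basis_vec_def)
    obtain f' where "((\<lambda>z. f z $ i) has_derivative f') (at z within S)"
      using assms[of i] unfolding differentiable_def by blast
    then have "((\<lambda>z. f z $ i \<bullet> u) has_derivative (\<lambda>h. f' h \<bullet> u)) (at z within S)"
      by (rule has_derivative_inner_left)
    then show ?thesis
      unfolding b inner_axis differentiable_def by blast
  qed
  then have "\<forall>b\<in>Basis. \<exists>f'. ((\<lambda>z. f z \<bullet> b) has_derivative f') (at z within S)"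
    by (auto simp: differentiable_def)
  then obtain f' where
    f': "\<And>b. b \<in> Basis \<Longrightarrow> ((\<lambda>z. f z \<bullet> b) has_derivative f' b) (at z within S)"
    by metis
  have "(f has_derivative (\<lambda>h. \<Sum>b\<in>Basis. f' b h *\<^sub>R b)) (at z within S)"
    by (subst has_derivative_componentwise_within) (simp add: f')
  then show ?thesis
    unfolding differentiable_def by blast
qed

lemma differentiable_vec_nth:
  "f differentiable F \<Longrightarrow> (\<lambda>z. f z $ i) differentiable F"
  unfolding differentiable_def
  using bounded_linear.has_derivative[OF bounded_linear_vec_nth] by blast

lemma differentiable_matrix_nth:
  "M differentiable F \<Longrightarrow> (\<lambda>z. M z $ i $ j) differentiable F"
  by (intro differentiable_vec_nth)

lemma differentiable_matrix_mult:
  fixes M :: "complex \<Rightarrow> complex^'n^'m" and P :: "complex \<Rightarrow> complex^'k^'n"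
  assumes "M differentiable (at z)" "P differentiable (at z)"
  shows "(\<lambda>w. M w ** P w) differentiable (at z)"
  by (intro differentiable_vecI)
     (auto simp: matrix_matrix_mult_def
       intro!: differentiable_sum differentiable_mult differentiable_matrix_nth assms)

lemma differentiable_prod:
  fixes f :: "'i \<Rightarrow> 'a::real_normed_vector \<Rightarrow> 'b::real_normed_field"
  assumes "\<And>i. i \<in> I \<Longrightarrow> f i differentiable (at z)"
  shows "(\<lambda>w. \<Prod>i\<in>I. f i w) differentiable (at z)"
  using assms
  by (induction I rule: infinite_finite_induct) (auto intro!: differentiable_mult)

lemma differentiable_det:
  fixes M :: "complex \<Rightarrow> complex^'n^'n"
  assumes "\<And>i j. (\<lambda>w. M w $ i $ j) differentiable (at z)"
  shows "(\<lambda>w. det (M w)) differentiable (at z)"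
  unfolding det_def
  by (auto intro!: differentiable_sum differentiable_mult differentiable_prod assms)

lemma matrix_inv_cancel:
  fixes M :: "'a::field^'n^'n"
  assumes "det M \<noteq> 0"
  shows "M ** matrix_inv M = mat 1" "matrix_inv M ** M = mat 1"
proof -
  have "invertible M"
    using assms by (simp add: invertible_det_nz)
  then have "M ** matrix_inv M = mat 1 \<and> matrix_inv M ** M = mat 1"
    unfolding invertible_def matrix_inv_def by (rule someI_ex)
  then show "M ** matrix_inv M = mat 1" "matrix_inv M ** M = mat 1"
    by auto
qed

text \<open>This is Cramer's rule for the linear system whose right-hand side is column \<open>l\<close> of \<open>P\<close>.\<close>

lemma matrix_inv_mult_nth:
  fixes M P :: "'a::field^'n^'n"
  assumes "det M \<noteq> 0"
  shows "(matrix_inv M ** P) $ k $ l =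
           det (\<chi> i j. if j = k then P $ i $ l else M $ i $ j) / det M"
proof -
  let ?X = "matrix_inv M ** P"
  have "M ** ?X = P"
    by (simp add: matrix_mul_assoc matrix_inv_cancel assms)
  then have "M *v column l ?X = column l P"
    by (auto simp: vec_eq_iff matrix_vector_mult_def matrix_matrix_mult_def column_def)
  then have "column l ?X = (\<chi> k. det (\<chi> i j. if j = k then column l P $ i else M $ i $ j) / det M)"
    using cramer[OF assms] by blast
  then have "column l ?X $ k = det (\<chi> i j. if j = k then column l P $ i else M $ i $ j) / det M"
    by simp
  then show ?thesis
    by (simp add: column_def cong: if_cong)
qed

text \<open>By Cramer's rule the entries of \<open>M\<^sup>-\<^sup>1 P\<close> are quotients of determinants, hence
  rational in the entries of \<open>M\<close> and \<open>P\<close>. Openness is used because differentiability at a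
  point depends on a neighbourhood, on which Cramer's rule has to hold.\<close>

lemma differentiable_matrix_inv_mult:
  fixes M P :: "complex \<Rightarrow> complex^'n^'n"
  assumes "M differentiable (at z)" "P differentiable (at z)"
    and "open D" "z \<in> D" "\<And>w. w \<in> D \<Longrightarrow> det (M w) \<noteq> 0"
  shows "(\<lambda>w. matrix_inv (M w) ** P w) differentiable (at z)"
proof (intro differentiable_vecI)
  fix k l
  let ?q = "\<lambda>w. det (\<chi> i j. if j = k then P w $ i $ l else M w $ i $ j) / det (M w)"
  have "(\<lambda>w. if j = k then P w $ i $ l else M w $ i $ j) differentiable (at z)" for i j
    by (cases "j = k") (auto intro!: differentiable_matrix_nth assms(1,2))
  then have "?q differentiable (at z)"
    by (intro differentiable_divide differentiable_det)
       (auto intro!: differentiable_matrix_nth assms)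
  then obtain q' where "(?q has_derivative q') (at z)"
    unfolding differentiable_def by blast
  then have "((\<lambda>w. (matrix_inv (M w) ** P w) $ k $ l) has_derivative q') (at z)"
    by (rule has_derivative_transform_within_open[OF _ assms(3,4)])
       (simp add: matrix_inv_mult_nth assms(5))
  then show "(\<lambda>w. (matrix_inv (M w) ** P w) $ k $ l) differentiable (at z)"
    unfolding differentiable_def by blast
qed

section \<open>Calculus of the d-bar operator\<close>

lemma dbar_eq:
  assumes "(f has_derivative f') (at z)"
  shows "dbar f z = (f' 1 + \<i> * f' \<i>) / 2"
  unfolding dbar_def using frechet_derivative_at[OF assms] by simp

lemma dbar_diff:
  assumes "f differentiable (at z)" "g differentiable (at z)"
  shows "dbar (\<lambda>w. f w - g w) z = dbar f z - dbar g z"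
proof -
  obtain f' g' where D: "(f has_derivative f') (at z)" "(g has_derivative g') (at z)"
    using assms unfolding differentiable_def by blast
  show ?thesis
    unfolding dbar_eq[OF has_derivative_diff[OF D]] dbar_eq[OF D(1)] dbar_eq[OF D(2)]
    by (simp add: field_simps)
qed

lemma dbar_mult:
  assumes "f differentiable (at z)" "g differentiable (at z)"
  shows "dbar (\<lambda>w. f w * g w) z = dbar f z * g z + f z * dbar g z"
proof -
  obtain f' g' where D: "(f has_derivative f') (at z)" "(g has_derivative g') (at z)"
    using assms unfolding differentiable_def by blast
  show ?thesis
    unfolding dbar_eq[OF has_derivative_mult[OF D]] dbar_eq[OF D(1)] dbar_eq[OF D(2)]
    by (simp add: field_simps)
qed

lemma dbar_sum:
  assumes "\<And>i. i \<in> I \<Longrightarrow> f i differentiable (at z)"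
  shows "dbar (\<lambda>w. \<Sum>i\<in>I. f i w) z = (\<Sum>i\<in>I. dbar (f i) z)"
proof -
  have D: "(f i has_derivative frechet_derivative (f i) (at z)) (at z)" if "i \<in> I" for i
    using assms[OF that] by (simp add: frechet_derivative_works)
  have "((\<lambda>w. \<Sum>i\<in>I. f i w) has_derivative
      (\<lambda>h. \<Sum>i\<in>I. frechet_derivative (f i) (at z) h)) (at z)"
    by (rule has_derivative_sum) (rule D)
  from dbar_eq[OF this] show ?thesis
    by (simp add: dbar_def sum_distrib_left sum.distrib flip: sum_divide_distrib)
qed

lemma mat_dbar_diff:
  assumes "M differentiable (at z)" "P differentiable (at z)"
  shows "mat_dbar (\<lambda>w. M w - P w) z = mat_dbar M z - mat_dbar P z"
  by (simp add: mat_dbar_def vec_eq_iff dbar_diff differentiable_matrix_nth assms)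

lemma mat_dbar_mult:
  fixes M P :: "complex \<Rightarrow> complex^'n^'n"
  assumes "M differentiable (at z)" "P differentiable (at z)"
  shows "mat_dbar (\<lambda>w. M w ** P w) z = mat_dbar M z ** P z + M z ** mat_dbar P z"
  by (simp add: mat_dbar_def vec_eq_iff matrix_matrix_mult_def dbar_sum dbar_mult sum.distrib
      differentiable_mult differentiable_matrix_nth assms)

lemma mat_dbar_cong_open:
  assumes "M differentiable (at z)" "open D" "z \<in> D" "\<And>w. w \<in> D \<Longrightarrow> M w = P w"
  shows "mat_dbar M z = mat_dbar P z"
proof -
  have "frechet_derivative (\<lambda>w. M w $ i $ j) (at z) = frechet_derivative (\<lambda>w. P w $ i $ j) (at z)"
    for i j
    by (rule frechet_derivative_transform_within_open
        [OF differentiable_matrix_nth[OF assms(1)] assms(2,3)]) (simp add: assms(4))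
  then show ?thesis
    by (simp add: mat_dbar_def dbar_def)
qed

lemma matrix_add_rdistrib:
  fixes A B C :: "'a::ring_1^'n^'n"
  shows "(A + B) ** C = A ** C + B ** C"
  by (vector matrix_matrix_mult_def sum.distrib distrib_right)

lemma matrix_diff_ldistrib:
  fixes A B C :: "'a::ring_1^'n^'n"
  shows "A ** (B - C) = A ** B - A ** C"
  by (vector matrix_matrix_mult_def sum_subtractf right_diff_distrib)

text \<open>Differentiating the relation \<open>M W = P\<close> determines \<open>\<partial>W\<close> without a formula for the
  derivative of an inverse.\<close>

lemma mat_dbar_matrix_inv_mult:
  fixes M P :: "complex \<Rightarrow> complex^'n^'n"
  assumes "M differentiable (at z)" "P differentiable (at z)"
    and "open D" "z \<in> D" "\<And>w. w \<in> D \<Longrightarrow> det (M w) \<noteq> 0"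
  shows "mat_dbar (\<lambda>w. matrix_inv (M w) ** P w) z =
           matrix_inv (M z) ** (mat_dbar P z - mat_dbar M z ** (matrix_inv (M z) ** P z))"
proof -
  let ?W = "\<lambda>w. matrix_inv (M w) ** P w"
  have W: "?W differentiable (at z)"
    by (rule differentiable_matrix_inv_mult[OF assms])
  have "mat_dbar P z = mat_dbar (\<lambda>w. M w ** ?W w) z"
    by (rule mat_dbar_cong_open[OF assms(2-4)])
       (simp add: matrix_mul_assoc matrix_inv_cancel assms(5))
  also have "\<dots> = mat_dbar M z ** ?W z + M z ** mat_dbar ?W z"
    by (rule mat_dbar_mult[OF assms(1) W])
  finally have "M z ** mat_dbar ?W z = mat_dbar P z - mat_dbar M z ** ?W z"
    by simp
  then have "matrix_inv (M z) ** (M z ** mat_dbar ?W z) =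
      matrix_inv (M z) ** (mat_dbar P z - mat_dbar M z ** ?W z)"
    by simp
  moreover have "matrix_inv (M z) ** (M z ** mat_dbar ?W z) = mat_dbar ?W z"
    unfolding matrix_mul_assoc by (simp add: matrix_inv_cancel assms(4,5))
  ultimately show ?thesis
    by simp
qed

section \<open>The transformed system\<close>

theorem proposition1:
  fixes D :: "complex set"
    and A F Fp \<omega>F :: "complex \<Rightarrow> complex^'n^'n"
  assumes "open D" and "D \<noteq> {}" and "simply_connected D"
    and "solves_system D A F"
    and "is_potential D Fp F \<omega>F"
    and "\<And>z. z \<in> D \<Longrightarrow> det (\<omega>F z) \<noteq> 0"
  shows "\<forall>\<Psi> \<omega>\<Psi>. solves_system D A \<Psi> \<longrightarrow> is_potential D Fp \<Psi> \<omega>\<Psi> \<longrightarrow>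
           solves_system D
             (\<lambda>z. A z + F z ** matrix_inv (\<omega>F z) ** Fp z)
             (\<lambda>z. \<Psi> z - F z ** matrix_inv (\<omega>F z) ** \<omega>\<Psi> z)"
proof (intro allI impI)
  fix \<Psi> \<omega>\<Psi> :: "complex \<Rightarrow> complex^'n^'n"
  assume \<Psi>: "solves_system D A \<Psi>" and \<omega>\<Psi>: "is_potential D Fp \<Psi> \<omega>\<Psi>"
  define W where "W = (\<lambda>w. matrix_inv (\<omega>F w) ** \<omega>\<Psi> w)"
  define \<Psi>' where "\<Psi>' = (\<lambda>w. \<Psi> w - F w ** W w)"
  have "\<Psi>' differentiable (at z) \<and>
      mat_dbar \<Psi>' z + (A z + F z ** matrix_inv (\<omega>F z) ** Fp z) ** \<Psi>' z = 0"
    if z: "z \<in> D" for z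
  proof
    have F: "F differentiable (at z)" "mat_dbar F z = - (A z ** F z)"
      and \<Psi>_z: "\<Psi> differentiable (at z)" "mat_dbar \<Psi> z = - (A z ** \<Psi> z)"
      and \<omega>F: "\<omega>F differentiable (at z)" "mat_dbar \<omega>F z = Fp z ** F z"
      and \<omega>\<Psi>_z: "\<omega>\<Psi> differentiable (at z)" "mat_dbar \<omega>\<Psi> z = Fp z ** \<Psi> z"
      using assms(4,5) \<Psi> \<omega>\<Psi> z
      by (auto simp: solves_system_def is_potential_def add_eq_0_iff2)
    have W: "W differentiable (at z)"
      unfolding W_def
      by (rule differentiable_matrix_inv_mult[OF \<omega>F(1) \<omega>\<Psi>_z(1) assms(1) z assms(6)])
    have FW: "(\<lambda>w. F w ** W w) differentiable (at z)"
      by (rule differentiable_matrix_mult[OF F(1) W])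
    show "\<Psi>' differentiable (at z)"
      unfolding \<Psi>'_def by (rule differentiable_diff[OF \<Psi>_z(1) FW])
    have "mat_dbar W z = matrix_inv (\<omega>F z) ** (Fp z ** \<Psi> z - Fp z ** F z ** W z)"
      unfolding W_def
      using mat_dbar_matrix_inv_mult[OF \<omega>F(1) \<omega>\<Psi>_z(1) assms(1) z assms(6)]
      by (simp add: \<omega>F(2) \<omega>\<Psi>_z(2))
    then have dW: "mat_dbar W z = matrix_inv (\<omega>F z) ** (Fp z ** \<Psi>' z)"
      by (simp add: \<Psi>'_def matrix_diff_ldistrib matrix_mul_assoc)
    have neg: "(- (A z ** F z)) ** W z = - (A z ** (F z ** W z))"
      unfolding matrix_mul_assoc by (vector matrix_matrix_mult_def sum_negf)
    have "mat_dbar \<Psi>' z = mat_dbar \<Psi> z - (mat_dbar F z ** W z + F z ** mat_dbar W z)"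
      unfolding \<Psi>'_def
      by (simp add: mat_dbar_diff[OF \<Psi>_z(1) FW] mat_dbar_mult[OF F(1) W])
    also have "\<dots> = - (A z ** \<Psi>' z) - F z ** mat_dbar W z"
      by (simp add: F(2) \<Psi>_z(2) neg \<Psi>'_def matrix_diff_ldistrib)
    finally show "mat_dbar \<Psi>' z + (A z + F z ** matrix_inv (\<omega>F z) ** Fp z) ** \<Psi>' z = 0"
      by (simp add: dW matrix_add_rdistrib matrix_mul_assoc)
  qed
  then show "solves_system D
      (\<lambda>z. A z + F z ** matrix_inv (\<omega>F z) ** Fp z)
      (\<lambda>z. \<Psi> z - F z ** matrix_inv (\<omega>F z) ** \<omega>\<Psi> z)"
    unfolding solves_system_def \<Psi>'_def W_def matrix_mul_assoc by blast
qed

end
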